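(* Let $E$ be a row-finite directed graph. The path groupoid $G_E$ is principal if and only if $E$ contains no cycles.
   Context: A directed graph $E=(E^0,E^1,r,s)$ consists of countable sets $E^0$ (vertices), $E^1$ (edges) and maps $r,s:E^1\to E^0$. It is row-finite if $r^{-1}(v)$ is finite for every $v\in E^0$. A finite path of length $k\geq 1$ is a sequence $\alpha=\alpha_1\alpha_2\cdots\alpha_k$ of edges with $s(\alpha_j)=r(\alpha_{j+1})$ for $1\le j\le k-1$; $r(\alpha)=r(\alpha_1)$, $s(\alpha)=s(\alpha_k)$; vertices are paths of length $0$. An infinite path is a sequence $x=x_1x_2\cdots$ of edges with $s(x_j)=r(x_{j+1})$ for all $j$; $E^\infty$ is the set of infinite paths. A cycle is a finite path $\alpha$ of non-zero length with $r(\alpha)=s(\alpha)$ and $s(\alpha_i)\ne s(\alpha_j)$ for $i\ne j$. For $x,y\in E^\infty$ and $n\in\mathbb Z$, write $x\sim_n y$ if there is $m\in\mathbb N$ such that $x_i=y_{i-n}$ for all $i\ge m$. The path groupoid is $G_E=\{(x,n,y)\in E^\infty\times\mathbb Z\times E^\infty:x\sim_n y\}$ with $(x,n,y)(y,m,z)=(x,n+m,z)$ and $(x,n,y)^{-1}=(y,-n,x)$. A groupoid is principal if any two elements with the same range and the same source are equal, where $r(\gamma)=\gamma\gamma^{-1}$ and $s(\gamma)=\gamma^{-1}\gamma$. *)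

theory Defs
  imports "Graph_Theory.Digraph" "HOL-Library.Countable_Set"
begin

text \<open>
  A directed graph \<open>E = (E\<^sup>0, E\<^sup>1, r, s)\<close> is a record with \<open>verts E = E\<^sup>0\<close>, \<open>arcs E = E\<^sup>1\<close>,
  \<open>head E = r\<close> (range) and \<open>tail E = s\<close> (source); loops and parallel edges are allowed.
\<close>

locale countable_digraph = wf_digraph +
  assumes countable_verts: "countable (verts G)"
    and countable_arcs: "countable (arcs G)"

definition row_finite :: "('v, 'e) pre_digraph \<Rightarrow> bool" where
  "row_finite E \<longleftrightarrow> (\<forall>v \<in> verts E. finite {e \<in> arcs E. head E e = v})"


text \<open>
  A path satisfies \<open>s(\<alpha>\<^sub>j) = r(\<alpha>\<^sub>j\<^sub>+\<^sub>1)\<close>, so it is read from its range back to its source; this is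
  opposite to the order of the arc walks of \<open>Graph_Theory\<close>. Lists and sequences are indexed
  from 0, so that \<open>\<alpha> ! j\<close> and \<open>x j\<close> are the edges \<open>\<alpha>\<^sub>j\<^sub>+\<^sub>1\<close> and \<open>x\<^sub>j\<^sub>+\<^sub>1\<close>.
\<close>

definition finite_path :: "('v, 'e) pre_digraph \<Rightarrow> 'e list \<Rightarrow> bool" where
  "finite_path E \<alpha> \<longleftrightarrow> \<alpha> \<noteq> [] \<and> set \<alpha> \<subseteq> arcs E \<and>
     (\<forall>j. Suc j < length \<alpha> \<longrightarrow> tail E (\<alpha> ! j) = head E (\<alpha> ! Suc j))"

definition path_range :: "('v, 'e) pre_digraph \<Rightarrow> 'e list \<Rightarrow> 'v" where
  "path_range E \<alpha> = head E (hd \<alpha>)"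

definition path_source :: "('v, 'e) pre_digraph \<Rightarrow> 'e list \<Rightarrow> 'v" where
  "path_source E \<alpha> = tail E (last \<alpha>)"

definition is_cycle :: "('v, 'e) pre_digraph \<Rightarrow> 'e list \<Rightarrow> bool" where
  "is_cycle E \<alpha> \<longleftrightarrow> finite_path E \<alpha> \<and> path_range E \<alpha> = path_source E \<alpha> \<and>
     (\<forall>i < length \<alpha>. \<forall>j < length \<alpha>. i \<noteq> j \<longrightarrow> tail E (\<alpha> ! i) \<noteq> tail E (\<alpha> ! j))"

definition infinite_paths :: "('v, 'e) pre_digraph \<Rightarrow> (nat \<Rightarrow> 'e) set" where
  "infinite_paths E = {x. \<forall>j. x j \<in> arcs E \<and> tail E (x j) = head E (x (Suc j))}"


text \<open>
  \<open>shift_equiv x n y\<close> is the relation \<open>x \<sim>\<^sub>n y\<close>. The conjunct \<open>n \<le> int i\<close> says that \<open>i - n\<close> is an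
  index of \<open>y\<close>. The relation does not change if both sequences are indexed from 1 instead of 0.
\<close>

definition shift_equiv :: "(nat \<Rightarrow> 'e) \<Rightarrow> int \<Rightarrow> (nat \<Rightarrow> 'e) \<Rightarrow> bool" where
  "shift_equiv x n y \<longleftrightarrow> (\<exists>m. \<forall>i\<ge>m. n \<le> int i \<and> x i = y (nat (int i - n)))"


text \<open>
  \<open>gmult\<close> and \<open>ginv\<close> are total functions; only their values on composable pairs and on arrows
  are meaningful.
\<close>

record 'g pre_groupoid =
  arrows :: "'g set"
  composable :: "('g \<times> 'g) set"
  gmult :: "'g \<Rightarrow> 'g \<Rightarrow> 'g"
  ginv :: "'g \<Rightarrow> 'g"

locale groupoid =
  fixes G :: "'g pre_groupoid"
  assumes composable_arrows: "composable G \<subseteq> arrows G \<times> arrows G"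
    and gmult_closed: "(a, b) \<in> composable G \<Longrightarrow> gmult G a b \<in> arrows G"
    and ginv_closed: "a \<in> arrows G \<Longrightarrow> ginv G a \<in> arrows G"
    and assoc_composable:
      "\<lbrakk>(a, b) \<in> composable G; (b, c) \<in> composable G\<rbrakk> \<Longrightarrow>
         (gmult G a b, c) \<in> composable G \<and> (a, gmult G b c) \<in> composable G"
    and gmult_assoc:
      "\<lbrakk>(a, b) \<in> composable G; (b, c) \<in> composable G\<rbrakk> \<Longrightarrow>
         gmult G (gmult G a b) c = gmult G a (gmult G b c)"
    and ginv_ginv: "a \<in> arrows G \<Longrightarrow> ginv G (ginv G a) = a"
    and ginv_composable: "a \<in> arrows G \<Longrightarrow> (a, ginv G a) \<in> composable G"
    and ginv_left: "(a, b) \<in> composable G \<Longrightarrow> gmult G (ginv G a) (gmult G a b) = b"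
    and ginv_right: "(a, b) \<in> composable G \<Longrightarrow> gmult G (gmult G a b) (ginv G b) = a"

definition grange :: "'g pre_groupoid \<Rightarrow> 'g \<Rightarrow> 'g" where
  "grange G \<gamma> = gmult G \<gamma> (ginv G \<gamma>)"

definition gsource :: "'g pre_groupoid \<Rightarrow> 'g \<Rightarrow> 'g" where
  "gsource G \<gamma> = gmult G (ginv G \<gamma>) \<gamma>"

definition principal_groupoid :: "'g pre_groupoid \<Rightarrow> bool" where
  "principal_groupoid G \<longleftrightarrow> (\<forall>\<gamma> \<in> arrows G. \<forall>\<delta> \<in> arrows G.
     grange G \<gamma> = grange G \<delta> \<and> gsource G \<gamma> = gsource G \<delta> \<longrightarrow> \<gamma> = \<delta>)"


definition path_arrows :: "('v, 'e) pre_digraph \<Rightarrow> ((nat \<Rightarrow> 'e) \<times> int \<times> (nat \<Rightarrow> 'e)) set" where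
  "path_arrows E =
     {(x, n, y). x \<in> infinite_paths E \<and> y \<in> infinite_paths E \<and> shift_equiv x n y}"

definition path_groupoid ::
    "('v, 'e) pre_digraph \<Rightarrow> ((nat \<Rightarrow> 'e) \<times> int \<times> (nat \<Rightarrow> 'e)) pre_groupoid" where
  "path_groupoid E =
     \<lparr>arrows = path_arrows E,
      composable = {((x, n, y), (y', m, z)).
        (x, n, y) \<in> path_arrows E \<and> (y', m, z) \<in> path_arrows E \<and> y = y'},
      gmult = (\<lambda>(x, n, y) (y', m, z). (x, n + m, z)),
      ginv = (\<lambda>(x, n, y). (y, - n, x))\<rparr>"


lemma shift_equiv_trans:
  assumes "shift_equiv x n y" and "shift_equiv y m z"
  shows "shift_equiv x (n + m) z"
proof -
  obtain p where p: "\<And>i. i \<ge> p \<Longrightarrow> n \<le> int i \<and> x i = y (nat (int i - n))"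
    using assms(1) unfolding shift_equiv_def by blast
  obtain q where q: "\<And>i. i \<ge> q \<Longrightarrow> m \<le> int i \<and> y i = z (nat (int i - m))"
    using assms(2) unfolding shift_equiv_def by blast
  have "n + m \<le> int i \<and> x i = z (nat (int i - (n + m)))" if "i \<ge> max p (nat (int q + n))" for i
  proof -
    have i: "i \<ge> p" "nat (int i - n) \<ge> q" using that by auto
    have "int (nat (int i - n)) = int i - n" using p[OF i(1)] by simp
    then show ?thesis using p[OF i(1)] q[OF i(2)] by (simp add: algebra_simps)
  qed
  then show ?thesis unfolding shift_equiv_def by blast
qed

lemma shift_equiv_sym:
  assumes "shift_equiv x n y"
  shows "shift_equiv y (- n) x"
proof -
  obtain p where p: "\<And>i. i \<ge> p \<Longrightarrow> n \<le> int i \<and> x i = y (nat (int i - n))"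
    using assms unfolding shift_equiv_def by blast
  have "- n \<le> int i \<and> y i = x (nat (int i - (- n)))" if "i \<ge> nat (int p - n)" for i
  proof -
    have i: "nat (int i + n) \<ge> p" "int i + n \<ge> 0" using that by auto
    then show ?thesis using p[OF i(1)] by simp
  qed
  then show ?thesis unfolding shift_equiv_def by blast
qed

lemma groupoid_path_groupoid: "groupoid (path_groupoid E)"
  by unfold_locales
    (auto simp: path_groupoid_def path_arrows_def intro: shift_equiv_trans shift_equiv_sym)

end

theory Submission
  imports Defs
begin

text \<open>
  Winding around a cycle of length \<open>p\<close> gives an infinite path \<open>x\<close> with two distinct arrows
  \<open>(x, p, x)\<close> and \<open>(x, 0, x)\<close> of equal range and source. Conversely, two such arrows \<open>(x, n, y)\<close>
  and \<open>(x, m, y)\<close> with \<open>n \<noteq> m\<close> make \<open>x\<close> eventually periodic, so \<open>x\<close> visits some vertex twice, and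
  the shortest segment of \<open>x\<close> between two visits to the same vertex is a cycle.
\<close>

text \<open>The range and source of \<open>(x, n, y)\<close> are \<open>(x, 0, x)\<close> and
  \<open>(y, 0, y)\<close>: they determine \<open>x\<close> and \<open>y\<close> but forget
  \<open>n\<close>.\<close>

lemma path_groupoid_principal_iff:
  "principal_groupoid (path_groupoid E) \<longleftrightarrow>
     (\<forall>x n m y. (x, n, y) \<in> path_arrows E \<longrightarrow> (x, m, y) \<in> path_arrows E \<longrightarrow> n = m)"
  unfolding principal_groupoid_def grange_def gsource_def path_groupoid_def
  by (auto split: prod.splits)

lemma infinite_path_of_cycle:
  assumes "is_cycle E \<alpha>"
  shows "(\<lambda>i. \<alpha> ! (i mod length \<alpha>)) \<in> infinite_paths E"
proof -
  have ne: "\<alpha> \<noteq> []" and arcs: "set \<alpha> \<subseteq> arcs E"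
    and step: "\<And>j. Suc j < length \<alpha> \<Longrightarrow> tail E (\<alpha> ! j) = head E (\<alpha> ! Suc j)"
    and closed: "head E (\<alpha> ! 0) = tail E (\<alpha> ! (length \<alpha> - 1))"
    using assms
    by (auto simp: is_cycle_def finite_path_def path_range_def path_source_def
        hd_conv_nth last_conv_nth)
  \<comment> \<open>Inside one turn this is the path condition of \<alpha>; at the wrap-around from
    the last edge to the first it is \<open>closed\<close>.\<close>
  have "tail E (\<alpha> ! (i mod length \<alpha>)) = head E (\<alpha> ! (Suc i mod length \<alpha>))" for i
    using step[of "i mod length \<alpha>"] closed ne
    by (cases "Suc (i mod length \<alpha>) = length \<alpha>") (auto simp: mod_Suc Suc_lessI, metis diff_Suc_1')
  moreover have "\<alpha> ! (i mod length \<alpha>) \<in> arcs E" for i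
    using arcs ne by (auto intro!: subsetD[OF arcs] nth_mem)
  ultimately show ?thesis
    by (simp add: infinite_paths_def)
qed

lemma cycle_of_repeated_tail:
  assumes x: "x \<in> infinite_paths E" and "0 < d" "tail E (x i) = tail E (x (i + d))"
  shows "\<exists>\<alpha>. is_cycle E \<alpha>"
proof -
  \<comment> \<open>The position \<open>i\<close> is quantified inside \<open>P\<close>, so the
    least gap is minimal over all of \<open>x\<close>. A repeated source inside the chosen segment,
    at whatever position, would then be a smaller gap.\<close>
  define P where "P d \<longleftrightarrow> 0 < d \<and> (\<exists>i. tail E (x i) = tail E (x (i + d)))" for d
  have "P d"
    using assms by (auto simp: P_def)
  define k where "k = (LEAST d. P d)"
  have "P k" and least: "\<And>d. P d \<Longrightarrow> k \<le> d"
    using \<open>P d\<close> by (auto simp: k_def intro: LeastI Least_le)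
  then obtain i where "0 < k" and i: "tail E (x i) = tail E (x (i + k))"
    by (auto simp: P_def)
  \<comment> \<open>The segment starts at \<open>Suc i\<close> because the range of
    \<open>x (Suc i)\<close> is the source of \<open>x i\<close>, which is also the source of the
    last edge \<open>x (i + k)\<close>.\<close>
  define \<alpha> where "\<alpha> = map x [Suc i..<Suc i + k]"
  have len: "length \<alpha> = k" and nth: "\<And>j. j < k \<Longrightarrow> \<alpha> ! j = x (Suc i + j)"
    by (simp_all add: \<alpha>_def del: upt_Suc)
  have path: "x j \<in> arcs E" "tail E (x j) = head E (x (Suc j))" for j
    using x by (auto simp: infinite_paths_def)
  have "\<alpha> \<noteq> []"
    using len \<open>0 < k\<close> by auto
  have "finite_path E \<alpha>"
    using \<open>\<alpha> \<noteq> []\<close> path nth len by (auto simp: finite_path_def \<alpha>_def simp del: upt_Suc)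
  moreover have "path_range E \<alpha> = path_source E \<alpha>"
    using \<open>\<alpha> \<noteq> []\<close> \<open>0 < k\<close> path(2)[of i] i
    by (simp add: path_range_def path_source_def hd_conv_nth last_conv_nth len nth)
  moreover have "tail E (\<alpha> ! a) \<noteq> tail E (\<alpha> ! b)" if "a < b" "b < k" for a b
  proof
    assume "tail E (\<alpha> ! a) = tail E (\<alpha> ! b)"
    then have "tail E (x (Suc i + a)) = tail E (x (Suc i + a + (b - a)))"
      using that by (simp add: nth)
    then have "P (b - a)"
      using \<open>a < b\<close> unfolding P_def by fastforce
    then show False
      using least that by fastforce
  qed
  then have "\<forall>a<k. \<forall>b<k. a \<noteq> b \<longrightarrow> tail E (\<alpha> ! a) \<noteq> tail E (\<alpha> ! b)"
    by (metis nat_neq_iff)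
  ultimately show ?thesis
    by (auto simp: is_cycle_def len)
qed

lemma cycle_of_shift_equiv_self:
  assumes x: "x \<in> infinite_paths E" and "shift_equiv x n x" "n \<noteq> 0"
  shows "\<exists>\<alpha>. is_cycle E \<alpha>"
proof -
  \<comment> \<open>By symmetry of the relation, \<open>k\<close> can be taken to be whichever of
    \<open>n\<close> and \<open>- n\<close> is positive.\<close>
  obtain k where "0 < k" "shift_equiv x k x"
    using assms(2,3) shift_equiv_sym[OF assms(2)]
    by (meson linorder_neqE_linordered_idom neg_0_less_iff_less)
  then obtain m where m: "\<And>i. i \<ge> m \<Longrightarrow> k \<le> int i \<and> x i = x (nat (int i - k))"
    by (auto simp: shift_equiv_def)
  \<comment> \<open>The instance \<open>m[of m]\<close> gives \<open>k \<le> int m\<close>, so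
    \<open>nat\<close> does not truncate here, and it also says that the edges \<open>x m\<close>
    and \<open>x j\<close> coincide.\<close>
  define j where "j = nat (int m - k)"
  have "m = j + nat k"
    using m[of m] \<open>0 < k\<close> by (auto simp: j_def)
  then have "tail E (x j) = tail E (x (j + nat k))"
    using m[of m] by (simp add: j_def)
  then show ?thesis
    using cycle_of_repeated_tail[OF x] \<open>0 < k\<close> by (metis zero_less_nat_eq)
qed

theorem proposition2p4p6:
  fixes E :: "('v, 'e) pre_digraph"
  assumes "countable_digraph E"
    and "row_finite E"
  shows "principal_groupoid (path_groupoid E) \<longleftrightarrow> \<not> (\<exists>\<alpha>. is_cycle E \<alpha>)"
proof
  assume principal: "principal_groupoid (path_groupoid E)"
  show "\<not> (\<exists>\<alpha>. is_cycle E \<alpha>)"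
  proof
    assume "\<exists>\<alpha>. is_cycle E \<alpha>"
    then obtain \<alpha> where \<alpha>: "is_cycle E \<alpha>" ..
    define p where "p = length \<alpha>"
    define x where "x i = \<alpha> ! (i mod p)" for i
    have "0 < p"
      using \<alpha> by (auto simp: is_cycle_def finite_path_def p_def)
    have x: "x \<in> infinite_paths E"
      using infinite_path_of_cycle[OF \<alpha>] by (simp add: x_def[abs_def] p_def)
    \<comment> \<open>The bound \<open>p \<le> i\<close> keeps the shifted index nonnegative, so
      \<open>p\<close> serves as the threshold in \<open>shift_equiv\<close>.\<close>
    have "x i = x (nat (int i - int p))" if "p \<le> i" for i
      using that by (simp add: x_def nat_diff_distrib' le_mod_geq flip: of_nat_diff)
    then have "shift_equiv x (int p) x"
      unfolding shift_equiv_def by (intro exI[of _ p]) auto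
    moreover have "shift_equiv x 0 x"
      by (simp add: shift_equiv_def)
    ultimately have "int p = 0"
      using principal x unfolding path_groupoid_principal_iff path_arrows_def by blast
    then show False
      using \<open>0 < p\<close> by simp
  qed
next
  assume acyclic: "\<not> (\<exists>\<alpha>. is_cycle E \<alpha>)"
  have "n = m" if "(x, n, y) \<in> path_arrows E" "(x, m, y) \<in> path_arrows E" for x n m y
  proof -
    have x: "x \<in> infinite_paths E" and "shift_equiv x n y" "shift_equiv x m y"
      using that by (auto simp: path_arrows_def)
    \<comment> \<open>This is the product of \<open>(x, n, y)\<close> with the inverse of
      \<open>(x, m, y)\<close>; a nonzero degree \<open>n - m\<close> would produce a cycle.\<close>
    then have "shift_equiv x (n + - m) x"
      by (blast intro: shift_equiv_trans shift_equiv_sym)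
    then show ?thesis
      using acyclic cycle_of_shift_equiv_self[OF x] by fastforce
  qed
  then show "principal_groupoid (path_groupoid E)"
    unfolding path_groupoid_principal_iff by blast
qed

end
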